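(* Let $S=\{132,123\}$. For $n\ge1$ and $0\le c<n$, $$f_S(n,c,x)=\sum_{i=1}^{n}x^{\triangle_i}f_S(n-i,c+i,x),\qquad \triangle_i=\begin{cases}1,& n\in\{c+1,c+2,\ldots,c+i-1\},\\0,&\text{otherwise}.\end{cases}$$ Also, for $c\ge0$, $f_S(0,c,x)=f_S(1,c,x)=1$, and $f_S(n,c,x)=|\operatorname{Av}_n(132,123)|=2^{n-1}$ for $1\le n\le c$; and $f_S(n,c,1)=2^{n-1}$ for $n\ge1$. Moreover, writing $f_S(n,x)=f_S(n,0,x)$, for $n\ge1$, $$f_S(n+3,x)=f_S(n+2,x)+4f_S(n+1,x)-4f_S(n,x),$$ where $f_S(0,x)=1$, $f_S(1,x)=1$, $f_S(2,x)=2$ and $f_S(3,x)=x+3$.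
   Context: $\mathfrak S_n$ is the set of permutations of $\{1,\dots,n\}$. $\operatorname{Av}_n(S)$ is the set of $\pi\in\mathfrak S_n$ having no subsequence order-isomorphic to any element of $S$. For $\pi\in\mathfrak S_n$ and $c\in\mathbb Z$, the number of shifted double deficiencies of $\pi$ with shift $c$ is $$\operatorname{DD}_c(\pi)=\#\{j\in\{1,\ldots,n\}: 1\le j+c\le n,\ \pi(j)<j+c<\pi^{-1}(j+c)+c\}.$$ For $c=0$ this is the number $\operatorname{DD}(\pi)$ of double deficiencies, i.e. of indices $k$ with $\pi(k)<k<\pi^{-1}(k)$. For $n,c\ge0$, $f_S(n,c,x)=\sum_{\pi\in\operatorname{Av}_n(S)}x^{\operatorname{DD}_c(\pi)}$. The set $\{c+1,\ldots,c+i-1\}$ is empty when $i=1$. *)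

theory Defs
  imports
    "HOL-Library.Sublist"
    "HOL-Combinatorics.Permutations"
    "HOL-Computational_Algebra.Polynomial"
begin

(* A permutation in the symmetric group on {1..n} is a function p with p permutes {1..n};
   a pattern is a permutation given in one-line notation, so 132 is the list [1, 3, 2]. *)

definition one_line :: "nat \<Rightarrow> (nat \<Rightarrow> nat) \<Rightarrow> nat list" where
  "one_line n p = map p [1..<Suc n]"

definition order_isomorphic :: "nat list \<Rightarrow> nat list \<Rightarrow> bool" where
  "order_isomorphic xs ys \<longleftrightarrow> length xs = length ys \<and>
     (\<forall>i < length xs. \<forall>j < length xs. xs ! i < xs ! j \<longleftrightarrow> ys ! i < ys ! j)"

definition contains_pattern :: "nat list \<Rightarrow> nat list \<Rightarrow> bool" where
  "contains_pattern w s \<longleftrightarrow> (\<exists>u. subseq u w \<and> order_isomorphic u s)"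

definition Av :: "nat \<Rightarrow> nat list set \<Rightarrow> (nat \<Rightarrow> nat) set" where
  "Av n S = {p. p permutes {1..n} \<and> (\<forall>s\<in>S. \<not> contains_pattern (one_line n p) s)}"

(* The coercion nat is harmless: it is only relevant where 1 <= j + c. *)
definition DD :: "nat \<Rightarrow> int \<Rightarrow> (nat \<Rightarrow> nat) \<Rightarrow> nat" where
  "DD n c p = card {j \<in> {1..n}. 1 \<le> int j + c \<and> int j + c \<le> int n \<and>
     int (p j) < int j + c \<and> int j + c < int (inv p (nat (int j + c))) + c}"

(* dd_poly S n c is the polynomial f_S(n, c, x) in the indeterminate x. *)
definition dd_poly :: "nat list set \<Rightarrow> nat \<Rightarrow> nat \<Rightarrow> int poly" where
  "dd_poly S n c = (\<Sum>p\<in>Av n S. monom 1 (DD n (int c) p))"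

definition triangle :: "nat \<Rightarrow> nat \<Rightarrow> nat \<Rightarrow> nat" where
  "triangle n c i = (if n \<in> {c + 1..c + i - 1} then 1 else 0)"

end

theory Submission
  imports Defs
begin

text \<open>
  Avoiding both 132 and 123 means that no entry has two larger entries to its right.  Look at
  the position \<open>i\<close> of the maximum \<open>n\<close>.  Each entry before it already has one larger entry to
  its right, namely \<open>n\<close>, and so exceeds every other later entry.  Hence the one-line notation is
  \[ n-1,\; n-2,\; \ldots,\; n-i+1,\; n,\; \sigma \]
  with an arbitrary avoider \<open>\<sigma>\<close> of length \<open>n - i\<close>, and every such word is an avoider
  (lemma \<open>avoiders_eq_Union\<close>).

  Positions in \<open>\<sigma>\<close> are moved by \<open>i\<close> while its values are unchanged, so the shift \<open>c\<close> for the whole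
  permutation becomes the shift \<open>c + i\<close> for \<open>\<sigma>\<close>.  An index \<open>j\<close> in the leading block can be
  counted only for the value \<open>j + c = n\<close>: on the decreasing part the permutation is \<open>j \<mapsto> n - j\<close>, its
  own inverse, so for the smaller values the two required inequalities contradict each other.  The
  index \<open>n - c\<close> is counted exactly if it is a position strictly before \<open>i\<close>
  (lemma \<open>DD_prepend_block\<close>).  Summation gives the recurrence for \<open>f n c\<close>, and the same decomposition without weights gives the count \<open>2 ^ (n - 1)\<close>.

  The recurrence preserves \<open>n + c\<close>.  Fix the antidiagonal \<open>n + c = N\<close> and let \<open>N < 2 * m\<close>.  In the
  expansion of \<open>f m (N - m)\<close> the summand of length \<open>k\<close> has weight \<open>x\<close> if \<open>k < N - m\<close> and \<open>1\<close> otherwise.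
  The summands with \<open>k < N - m\<close> are plain counts, because their length is at most their shift, and
  add up to a power of two or to \<open>0\<close>.  So the partial sums on the antidiagonal satisfy a
  first-order linear recurrence.  Solving it gives
  \[ f (n + 1, x) = 2^n + (x - 1) \sum_{k < \lfloor n/2 \rfloor} 4^k, \]
  a linear combination of \<open>n\<close>-th powers of the roots \<open>1, 2, -2\<close> of
  \<open>t ^ 3 - t ^ 2 - 4 * t + 4\<close>; this is the three-term recurrence.
\<close>

section \<open>Avoidance of 132 and 123 in terms of positions\<close>

lemma subseq_Cons_iff_nth:
  "subseq (x # xs) w \<longleftrightarrow> (\<exists>i<length w. w ! i = x \<and> subseq xs (drop (Suc i) w))"
proof
  assume "subseq (x # xs) w"
  then obtain us vs where w: "w = us @ x # vs" and "subseq xs vs"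
    by (auto dest: list_emb_ConsD)
  then show "\<exists>i<length w. w ! i = x \<and> subseq xs (drop (Suc i) w)"
    by (intro exI[of _ "length us"]) auto
next
  assume "\<exists>i<length w. w ! i = x \<and> subseq xs (drop (Suc i) w)"
  then obtain i where i: "i < length w" "w ! i = x" "subseq xs (drop (Suc i) w)" by blast
  then have "subseq (x # xs) (drop i w)"
    by (simp add: Cons_nth_drop_Suc[symmetric])
  then show "subseq (x # xs) w"
    by (metis list_emb_append2 append_take_drop_id)
qed

lemma subseq_triple_iff:
  "subseq [x, y, z] w \<longleftrightarrow>
     (\<exists>a b c. a < b \<and> b < c \<and> c < length w \<and> w ! a = x \<and> w ! b = y \<and> w ! c = z)"
  (is "?L \<longleftrightarrow> ?R")
proof
  assume ?L
  then obtain a where a: "a < length w" "w ! a = x" and "subseq [y, z] (drop (Suc a) w)"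
    unfolding subseq_Cons_iff_nth[of x] by blast
  then obtain j where j: "j < length w - Suc a" "w ! (Suc a + j) = y"
    and "subseq [z] (drop (Suc j) (drop (Suc a) w))"
    unfolding subseq_Cons_iff_nth[of y] by auto
  then obtain k where k: "k < length w - Suc (Suc (a + j))" "w ! (Suc (Suc a + j) + k) = z"
    unfolding subseq_Cons_iff_nth[of z] by (auto simp: ac_simps)
  from a j k show ?R
    by (intro exI[of _ a] exI[of _ "Suc a + j"] exI[of _ "Suc (Suc a + j) + k"]) auto
next
  assume ?R
  then obtain a b c where abc: "a < b" "b < c" "c < length w" "w ! a = x" "w ! b = y" "w ! c = z"
    by blast
  have "subseq [z] (drop (Suc b) w)"
    unfolding subseq_Cons_iff_nth using abc by (intro exI[of _ "c - Suc b"]) auto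
  then have "subseq [y, z] (drop (Suc a) w)"
    unfolding subseq_Cons_iff_nth[of y] using abc by (intro exI[of _ "b - Suc a"]) auto
  then show ?L
    unfolding subseq_Cons_iff_nth[of x] using abc by (intro exI[of _ a]) auto
qed

lemma order_isomorphic_triple_iff:
  "order_isomorphic u [a, b, c] \<longleftrightarrow> (\<exists>x y z. u = [x, y, z] \<and>
     (x < y \<longleftrightarrow> a < b) \<and> (y < x \<longleftrightarrow> b < a) \<and> (x < z \<longleftrightarrow> a < c) \<and>
     (z < x \<longleftrightarrow> c < a) \<and> (y < z \<longleftrightarrow> b < c) \<and> (z < y \<longleftrightarrow> c < b))"
  (is "_ \<longleftrightarrow> (\<exists>x y z. u = [x, y, z] \<and> ?P x y z)")
proof -
  have three: "(\<forall>i < Suc (Suc (Suc 0)). Q i) \<longleftrightarrow> Q 0 \<and> Q (Suc 0) \<and> Q (Suc (Suc 0))" for Q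
    by (auto simp: less_Suc_eq)
  have eq: "order_isomorphic [x, y, z] [a, b, c] \<longleftrightarrow> ?P x y z" for x y z
    by (simp add: order_isomorphic_def three) blast
  show ?thesis
  proof
    assume u: "order_isomorphic u [a, b, c]"
    then have "length u = Suc (Suc (Suc 0))" by (simp add: order_isomorphic_def)
    then obtain x y z where "u = [x, y, z]" by (auto simp: length_Suc_conv)
    with u eq[of x y z] show "\<exists>x y z. u = [x, y, z] \<and> ?P x y z" by blast
  next
    assume "\<exists>x y z. u = [x, y, z] \<and> ?P x y z"
    then obtain x y z where "u = [x, y, z]" "?P x y z" by (elim exE conjE) (rule that; blast)
    with eq[of x y z] show "order_isomorphic u [a, b, c]" by blast
  qed
qed

lemma ex_subseq_triple_iff:
  "(\<exists>x y z. subseq [x, y, z] w \<and> P x y z) \<longleftrightarrow>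
     (\<exists>a b c. a < b \<and> b < c \<and> c < length w \<and> P (w ! a) (w ! b) (w ! c))"
  (is "?L \<longleftrightarrow> ?R")
proof
  assume ?L
  then obtain x y z where "subseq [x, y, z] w" and P: "P x y z" by blast
  with subseq_triple_iff[of x y z w] show ?R by auto
next
  assume ?R
  then obtain a b c where "a < b" "b < c" "c < length w" "P (w ! a) (w ! b) (w ! c)" by blast
  with subseq_triple_iff[of "w ! a" "w ! b" "w ! c" w] show ?L by blast
qed

lemma contains_132_iff:
  "contains_pattern w [1, 3, 2] \<longleftrightarrow>
     (\<exists>a b c. a < b \<and> b < c \<and> c < length w \<and> w ! a < w ! c \<and> w ! c < w ! b)"
proof -
  have "order_isomorphic u [1, 3, 2] \<longleftrightarrow> (\<exists>x y z. u = [x, y, z] \<and> x < z \<and> z < y)" for u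
    unfolding order_isomorphic_triple_iff by fastforce
  then have "contains_pattern w [1, 3, 2] \<longleftrightarrow> (\<exists>x y z. subseq [x, y, z] w \<and> x < z \<and> z < y)"
    unfolding contains_pattern_def by metis
  then show ?thesis
    by (simp only: ex_subseq_triple_iff)
qed

lemma contains_123_iff:
  "contains_pattern w [1, 2, 3] \<longleftrightarrow>
     (\<exists>a b c. a < b \<and> b < c \<and> c < length w \<and> w ! a < w ! b \<and> w ! b < w ! c)"
proof -
  have "order_isomorphic u [1, 2, 3] \<longleftrightarrow> (\<exists>x y z. u = [x, y, z] \<and> x < y \<and> y < z)" for u
    unfolding order_isomorphic_triple_iff by fastforce
  then have "contains_pattern w [1, 2, 3] \<longleftrightarrow> (\<exists>x y z. subseq [x, y, z] w \<and> x < y \<and> y < z)"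
    unfolding contains_pattern_def by metis
  then show ?thesis
    by (simp only: ex_subseq_triple_iff)
qed

definition avoiders :: "nat \<Rightarrow> (nat \<Rightarrow> nat) set" where
  "avoiders n = Av n {[1, 3, 2], [1, 2, 3]}"

lemma one_line_simps [simp]:
  "length (one_line n p) = n" "a < n \<Longrightarrow> one_line n p ! a = p (Suc a)"
  by (simp_all add: one_line_def del: upt_Suc)

text \<open>
  Two later entries exceeding \<open>p a\<close> are distinct by injectivity, so in either order they complete
  \<open>p a\<close> to one of the two patterns.
\<close>

lemma mem_avoiders_iff:
  "p \<in> avoiders n \<longleftrightarrow> p permutes {1..n} \<and>
     (\<forall>a b c. 1 \<le> a \<and> a < b \<and> b < c \<and> c \<le> n \<longrightarrow> \<not> (p a < p b \<and> p a < p c))"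
  (is "_ \<longleftrightarrow> _ \<and> ?R")
proof -
  have "(\<forall>s\<in>{[1, 3, 2], [1, 2, 3]}. \<not> contains_pattern (one_line n p) s) \<longleftrightarrow> ?R" (is "?L \<longleftrightarrow> _")
    if p: "p permutes {1..n}"
  proof
    assume L: ?L
    show ?R
    proof (intro allI impI notI)
      fix a b c assume abc: "1 \<le> a \<and> a < b \<and> b < c \<and> c \<le> n" "p a < p b \<and> p a < p c"
      then have "p b \<noteq> p c" using permutes_inj[OF p] by (auto dest: injD)
      moreover have "\<not> (p a < p c \<and> p c < p b)"
      proof
        assume "p a < p c \<and> p c < p b"
        then have "contains_pattern (one_line n p) [1, 3, 2]"
          unfolding contains_132_iff using abc
          by (intro exI[of _ "a - 1"] exI[of _ "b - 1"] exI[of _ "c - 1"]) auto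
        then show False using L by blast
      qed
      moreover have "\<not> (p a < p b \<and> p b < p c)"
      proof
        assume "p a < p b \<and> p b < p c"
        then have "contains_pattern (one_line n p) [1, 2, 3]"
          unfolding contains_123_iff using abc
          by (intro exI[of _ "a - 1"] exI[of _ "b - 1"] exI[of _ "c - 1"]) auto
        then show False using L by blast
      qed
      ultimately show False using abc by linarith
    qed
  next
    assume R: ?R
    have R': "\<not> (p (Suc a) < p (Suc b) \<and> p (Suc a) < p (Suc c))"
      if "a < b" "b < c" "c < n" for a b c
      using R that by (metis Suc_leI Suc_less_eq le_add1 plus_1_eq_Suc)
    have "\<not> contains_pattern (one_line n p) [1, 3, 2]"
    proof
      assume "contains_pattern (one_line n p) [1, 3, 2]"
      then obtain a b c where "a < b" "b < c" "c < n"
        "p (Suc a) < p (Suc c)" "p (Suc c) < p (Suc b)"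
        unfolding contains_132_iff by auto
      with R'[of a b c] show False by simp
    qed
    moreover have "\<not> contains_pattern (one_line n p) [1, 2, 3]"
    proof
      assume "contains_pattern (one_line n p) [1, 2, 3]"
      then obtain a b c where "a < b" "b < c" "c < n"
        "p (Suc a) < p (Suc b)" "p (Suc b) < p (Suc c)"
        unfolding contains_123_iff by auto
      with R'[of a b c] show False by simp
    qed
    ultimately show ?L by blast
  qed
  then show ?thesis unfolding avoiders_def Av_def by blast
qed

section \<open>Decomposition at the maximum\<close>

lemma triangle_eq: "triangle n c i = (if c < n \<and> n < c + i then 1 else 0)"
proof -
  have "n \<in> {c + 1..c + i - 1} \<longleftrightarrow> c < n \<and> n < c + i"
    unfolding atLeastAtMost_iff by linarith
  then show ?thesis by (simp only: triangle_def)
qed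

text \<open>
  The word \<open>n-1, \<dots>, n-i+1, n\<close> followed by \<open>q\<close>, extended by the identity outside \<open>{1..n}\<close> as
  \<open>permutes\<close> demands.
\<close>

definition prepend_block :: "nat \<Rightarrow> nat \<Rightarrow> (nat \<Rightarrow> nat) \<Rightarrow> nat \<Rightarrow> nat" where
  "prepend_block n i q j =
     (if j < 1 \<or> n < j then j else if j < i then n - j else if j = i then n else q (j - i))"

context
  fixes n i :: nat
  assumes i: "1 \<le> i" "i \<le> n"
begin

lemma prepend_block_permutes:
  assumes q: "q permutes {1..n - i}"
  shows "prepend_block n i q permutes {1..n}"
proof (rule bij_imp_permutes)
  have q_le: "1 \<le> q (k - i) \<and> q (k - i) \<le> n - i" if "i < k" "k \<le> n" for k
    using permutes_in_image[OF q, of "k - i"] that by auto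
  have "inj_on (prepend_block n i q) {1..n}"
  proof (rule linorder_inj_onI)
    fix a b assume ab: "a < b" "a \<in> {1..n}" "b \<in> {1..n}"
    show "prepend_block n i q a \<noteq> prepend_block n i q b"
    proof (cases "a \<le> i")
      case True
      then show ?thesis using ab i q_le[of b] by (auto simp: prepend_block_def)
    next
      case False
      then show ?thesis using ab i permutes_inj[OF q] by (auto simp: prepend_block_def dest!: injD)
    qed
  qed auto
  moreover have "prepend_block n i q ` {1..n} \<subseteq> {1..n}"
  proof
    fix v assume "v \<in> prepend_block n i q ` {1..n}"
    then obtain j where j: "1 \<le> j" "j \<le> n" "v = prepend_block n i q j" by auto
    then show "v \<in> {1..n}" using i q_le[of j] by (auto simp: prepend_block_def)
  qed
  ultimately show "bij_betw (prepend_block n i q) {1..n} {1..n}"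
    by (simp add: bij_betw_def endo_inj_surj)
qed (auto simp: prepend_block_def)

lemma prepend_block_in_avoiders:
  assumes "q \<in> avoiders (n - i)"
  shows "prepend_block n i q \<in> avoiders n"
proof -
  have q: "q permutes {1..n - i}" using assms by (simp add: mem_avoiders_iff)
  have q_le: "1 \<le> q (k - i) \<and> q (k - i) \<le> n - i" if "i < k" "k \<le> n" for k
    using permutes_in_image[OF q, of "k - i"] that by auto
  have "\<not> (prepend_block n i q a < prepend_block n i q b \<and>
            prepend_block n i q a < prepend_block n i q c)"
    if abc: "1 \<le> a" "a < b" "b < c" "c \<le> n" for a b c
  proof (cases "a \<le> i")
    case True
    then show ?thesis
      using abc i q_le[of b] q_le[of c] by (auto simp: prepend_block_def)
  next
    case False
    then have "\<not> (q (a - i) < q (b - i) \<and> q (a - i) < q (c - i))"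
      using assms abc unfolding mem_avoiders_iff
      by (elim conjE allE[of _ "a - i"] allE[of _ "b - i"] allE[of _ "c - i"]) auto
    then show ?thesis using False abc by (simp add: prepend_block_def)
  qed
  then show ?thesis using prepend_block_permutes[OF q] unfolding mem_avoiders_iff by blast
qed

lemma prepend_block_at [simp]: "prepend_block n i q i = n"
  using i by (simp add: prepend_block_def)

lemma inj_on_prepend_block: "inj_on (prepend_block n i) (avoiders (n - i))"
proof (rule inj_onI)
  fix q r assume qr: "q \<in> avoiders (n - i)" "r \<in> avoiders (n - i)"
    "prepend_block n i q = prepend_block n i r"
  show "q = r"
  proof
    fix k
    show "q k = r k"
    proof (cases "k \<in> {1..n - i}")
      case True
      then have "k \<noteq> 0" "k + i \<le> n" using i by auto
      then show ?thesis using fun_cong[OF qr(3), of "k + i"] by (simp add: prepend_block_def)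
    next
      case False
      then show ?thesis using qr(1,2) by (metis mem_avoiders_iff permutes_not_in)
    qed
  qed
qed

text \<open>
  For \<open>j < i\<close> the entries larger than \<open>p j\<close> sit exactly at the positions \<open>1, \<dots>, j - 1\<close> and \<open>i\<close>.
  There are \<open>j\<close> of them, which forces \<open>p j = n - j\<close>; the tail is left with the values up to
  \<open>n - i\<close>.
\<close>

lemma avoider_decomposition:
  assumes p: "p \<in> avoiders n" and pi: "p i = n"
  shows "p \<in> prepend_block n i ` avoiders (n - i)"
proof -
  have perm: "p permutes {1..n}" using p by (simp add: mem_avoiders_iff)
  have range: "1 \<le> p k \<and> p k \<le> n" if "1 \<le> k" "k \<le> n" for k
    using permutes_in_image[OF perm, of k] that by simp
  have inj: "p a = p b \<longleftrightarrow> a = b" for a b using permutes_inj[OF perm] by (auto dest: injD)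
  have avoid: "\<not> (p a < p b \<and> p a < p c)" if "1 \<le> a" "a < b" "b < c" "c \<le> n" for a b c
    using p that unfolding mem_avoiders_iff by blast
  have less_n: "p k < n" if "1 \<le> k" "k \<le> n" "k \<noteq> i" for k
    using range[of k] inj[of k i] that pi by (simp add: le_neq_implies_less)
  have desc: "p b < p a" if "1 \<le> a" "a < i" "a < b" "b \<noteq> i" "b \<le> n" for a b
  proof -
    have "p a < p i" using less_n[of a] that pi i by simp
    then have "\<not> p a < p b"
      using avoid[of a b i] avoid[of a i b] that i by (cases "b < i") auto
    then show ?thesis using inj[of a b] that by simp
  qed
  have block: "p j = n - j" if j: "1 \<le> j" "j < i" for j
  proof -
    have "p ` (insert i {1..<j}) = {p j<..n}"
    proof
      show "p ` (insert i {1..<j}) \<subseteq> {p j<..n}"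
        using pi j i less_n[of j] desc[of _ j] range by auto
      show "{p j<..n} \<subseteq> p ` (insert i {1..<j})"
      proof
        fix v assume v: "v \<in> {p j<..n}"
        then have "v \<in> p ` {1..n}" using permutes_image[OF perm] by auto
        then obtain k where k: "1 \<le> k" "k \<le> n" "v = p k" by auto
        then have "k = i \<or> k < j"
          using desc[of j k] j v by (cases j k rule: linorder_cases) auto
        then show "v \<in> p ` (insert i {1..<j})" using k by auto
      qed
    qed
    moreover have "card (p ` (insert i {1..<j})) = j"
      using j i by (subst card_image) (auto simp: inj_on_def inj)
    ultimately have "n - p j = j" by simp
    then show ?thesis using range[of j] j i by simp
  qed
  define q where "q k = (if 1 \<le> k \<and> k \<le> n - i then p (k + i) else k)" for k
  have tail: "p k \<le> n - i" if k: "i < k" "k \<le> n" for k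
  proof (rule ccontr)
    assume "\<not> p k \<le> n - i"
    then have "p (n - p k) = p k"
      using less_n[of k] i k by (subst block) auto
    then show False using k i range[of k] less_n[of k] \<open>\<not> p k \<le> n - i\<close> by (simp add: inj)
  qed
  have "q permutes {1..n - i}"
  proof (rule bij_imp_permutes)
    have "inj_on q {1..n - i}" by (auto simp: inj_on_def q_def inj)
    moreover have "q ` {1..n - i} \<subseteq> {1..n - i}"
      using tail range i by (auto simp: q_def)
    ultimately show "bij_betw q {1..n - i} {1..n - i}"
      by (simp add: bij_betw_def endo_inj_surj)
  qed (auto simp: q_def)
  moreover have "\<not> (q a < q b \<and> q a < q c)" if "1 \<le> a" "a < b" "b < c" "c \<le> n - i" for a b c
    using avoid[of "a + i" "b + i" "c + i"] that i by (simp add: q_def)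
  ultimately have "q \<in> avoiders (n - i)" unfolding mem_avoiders_iff by blast
  moreover have "p = prepend_block n i q"
  proof
    fix k show "p k = prepend_block n i q k"
      using permutes_not_in[OF perm, of k] block[of k] pi
      by (auto simp: prepend_block_def q_def)
  qed
  ultimately show ?thesis by blast
qed

text \<open>
  Position \<open>i\<close> carries \<open>n\<close>, which lies below no value.  A position \<open>j > i\<close> can only contribute
  through a value of the tail, since the values above \<open>n - i\<close> occur at positions up to \<open>i\<close>; this
  contribution is the one of \<open>j - i\<close> for \<open>q\<close> with shift
  \<open>c + i\<close>.  For \<open>j < i\<close> and \<open>v = j + c < n\<close>, being counted would need \<open>n - j < v\<close> and, as \<open>v\<close> then sits at
  position \<open>n - v\<close>, also \<open>j < n - v\<close>, which is impossible; only \<open>v = n\<close> remains.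
\<close>

lemma DD_prepend_block:
  assumes q: "q permutes {1..n - i}"
  shows "DD n (int c) (prepend_block n i q) =
           triangle n c i + DD (n - i) (int (c + i)) q"
proof -
  let ?p = "prepend_block n i q"
  have perm: "?p permutes {1..n}" using q by (rule prepend_block_permutes)
  have q_le: "1 \<le> q (k - i) \<and> q (k - i) \<le> n - i" if "i < k" "k \<le> n" for k
    using permutes_in_image[OF q, of "k - i"] that by auto
  have DD_eq: "DD m (int d) r = card {j \<in> {1..m}. j + d \<le> m \<and> r j < j + d \<and> j < inv r (j + d)}"
    for m d r
    unfolding DD_def by (rule arg_cong[where f = card]) (auto simp: nat_int_add nat_add_distrib)
  have inv_top: "inv ?p n = i"
    using permutes_inv_eq[OF perm] by simp
  have inv_block: "inv ?p (n - j) = j" if "1 \<le> j" "j < i" for j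
    using that i permutes_inv_eq[OF perm] by (simp add: prepend_block_def)
  have inv_tail: "inv ?p v = inv q v + i" if "1 \<le> v" "v \<le> n - i" for v
  proof -
    have "inv q v \<in> {1..n - i}"
      using permutes_in_image[OF permutes_inv[OF q], of v] that by simp
    then have "inv q v \<noteq> 0" "inv q v + i \<le> n" using i by auto
    then show ?thesis
      using permutes_inv_eq[OF perm, of v "inv q v + i"] permutes_inverses[OF q]
      by (simp add: prepend_block_def)
  qed
  let ?A = "{j. 1 \<le> j \<and> j < i \<and> j + c = n}"
  let ?B = "{j \<in> {1..n - i}. j + (c + i) \<le> n - i \<and> q j < j + (c + i) \<and> j < inv q (j + (c + i))}"
  have "j \<in> {1..n} \<and> j + c \<le> n \<and> ?p j < j + c \<and> j < inv ?p (j + c) \<longleftrightarrow>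
        j \<in> ?A \<or> j \<in> (\<lambda>k. k + i) ` ?B" for j
  proof (cases "j \<le> i")
    case True
    have "j + c = n" if "1 \<le> j" "j < i" "j + c \<le> n" "?p j < j + c" "j < inv ?p (j + c)"
    proof (rule ccontr)
      \<comment> \<open>The value \<open>j + c\<close> lies in the decreasing part, at position \<open>n - (j + c)\<close>.\<close>
      assume "j + c \<noteq> n"
      then have "1 \<le> n - (j + c)" "n - (j + c) < i" "n - j < j + c"
        using that i by (auto simp: prepend_block_def)
      then show False using that inv_block[of "n - (j + c)"] by simp
    qed
    then show ?thesis using True i inv_top by (auto simp: prepend_block_def)
  next
    case False
    then obtain k where k: "j = k + i" "1 \<le> k"
      by (intro that[of "j - i"]) auto
    have "k + i + c \<le> n - i" if "k + i + c \<le> n" "k + i < inv ?p (k + i + c)"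
    proof (rule ccontr)
      assume "\<not> k + i + c \<le> n - i"
      then have "n - (k + i + c) < i" "k + i + c = n \<or> 1 \<le> n - (k + i + c)" "n - (n - (k + i + c)) = k + i + c"
        using that i by linarith+
      then have "inv ?p (k + i + c) \<le> i"
        using inv_block[of "n - (k + i + c)"] inv_top by (elim disjE) auto
      then show False using that by simp
    qed
    then show ?thesis
      using k inv_tail[of "k + i + c"] i by (auto simp: prepend_block_def ac_simps)
  qed
  then have "{j \<in> {1..n}. j + c \<le> n \<and> ?p j < j + c \<and> j < inv ?p (j + c)} =
      ?A \<union> (\<lambda>k. k + i) ` ?B" by blast
  moreover have "card (?A \<union> (\<lambda>k. k + i) ` ?B) = card ?A + card ?B"
    by (subst card_Un_disjoint) (auto simp: card_image)
  moreover have "card ?A = triangle n c i"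
  proof (cases "c < n \<and> n < c + i")
    case True
    then have "?A = {n - c}" by auto
    then show ?thesis using True by (simp add: triangle_eq)
  next
    case False
    then have "?A = {}" by auto
    then show ?thesis using False i by (auto simp: triangle_eq)
  qed
  ultimately show ?thesis unfolding DD_eq by simp
qed

end

lemma finite_avoiders: "finite (avoiders n)"
  by (rule finite_subset[OF _ finite_permutations[of "{1..n}"]]) (auto simp: mem_avoiders_iff)

lemma avoiders_eq_Union:
  assumes "1 \<le> n"
  shows "avoiders n = (\<Union>i\<in>{1..n}. prepend_block n i ` avoiders (n - i))"
proof
  show "avoiders n \<subseteq> (\<Union>i\<in>{1..n}. prepend_block n i ` avoiders (n - i))"
  proof
    fix p assume p: "p \<in> avoiders n"
    then have perm: "p permutes {1..n}" by (simp add: mem_avoiders_iff)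
    have "n \<in> p ` {1..n}" using permutes_image[OF perm] assms by auto
    then obtain i where i: "1 \<le> i" "i \<le> n" "p i = n" by auto
    from i(1,2) p i(3) have "p \<in> prepend_block n i ` avoiders (n - i)"
      by (rule avoider_decomposition)
    then show "p \<in> (\<Union>i\<in>{1..n}. prepend_block n i ` avoiders (n - i))"
      using i(1,2) by (intro UN_I[of i]) simp_all
  qed
next
  show "(\<Union>i\<in>{1..n}. prepend_block n i ` avoiders (n - i)) \<subseteq> avoiders n"
    using prepend_block_in_avoiders by fastforce
qed

text \<open>The pieces of the decomposition are disjoint because \<open>i\<close> is the position of \<open>n\<close>.\<close>

lemma sum_avoiders:
  assumes "1 \<le> n"
  shows "(\<Sum>p\<in>avoiders n. g p) = (\<Sum>i = 1..n. \<Sum>q\<in>avoiders (n - i). g (prepend_block n i q))"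
proof -
  have "prepend_block n i ` avoiders (n - i) \<inter> prepend_block n j ` avoiders (n - j) = {}"
    if "i \<in> {1..n}" "j \<in> {1..n}" "i \<noteq> j" for i j
  proof -
    have "p k = n \<and> inj p" if kp: "k \<in> {1..n}" "p \<in> prepend_block n k ` avoiders (n - k)" for k p
    proof -
      have k: "1 \<le> k" "k \<le> n" using kp(1) by simp_all
      obtain q where q: "q \<in> avoiders (n - k)" "p = prepend_block n k q" using kp(2) by blast
      have "p permutes {1..n}"
        using prepend_block_in_avoiders[OF k q(1)] q(2) by (simp add: mem_avoiders_iff)
      then show ?thesis
        using prepend_block_at[OF k] q(2) by (simp add: permutes_inj)
    qed
    from this[OF \<open>i \<in> {1..n}\<close>] this[OF \<open>j \<in> {1..n}\<close>] show ?thesis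
      using \<open>i \<noteq> j\<close> by (metis disjoint_iff injD)
  qed
  then have "(\<Sum>p\<in>avoiders n. g p) =
      (\<Sum>i = 1..n. \<Sum>p\<in>prepend_block n i ` avoiders (n - i). g p)"
    unfolding avoiders_eq_Union[OF assms] by (intro sum.UNION_disjoint) (auto simp: finite_avoiders)
  also have "\<dots> = (\<Sum>i = 1..n. \<Sum>q\<in>avoiders (n - i). g (prepend_block n i q))"
    by (rule sum.cong) (auto simp: sum.reindex[OF inj_on_prepend_block])
  finally show ?thesis .
qed

section \<open>The recurrence and the number of avoiders\<close>

definition f :: "nat \<Rightarrow> nat \<Rightarrow> int poly" where
  "f = dd_poly {[1, 3, 2], [1, 2, 3]}"

lemma f_eq_sum: "f n c = (\<Sum>p\<in>avoiders n. monom 1 (DD n (int c) p))"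
  by (simp add: f_def dd_poly_def avoiders_def)

text \<open>
  This also covers \<open>n \<le> c\<close>, where all weights are trivial, so the recurrence can be iterated
  along an antidiagonal without a side condition on the shift.
\<close>

lemma f_recurrence:
  assumes "1 \<le> n"
  shows "f n c = (\<Sum>i = 1..n. monom 1 (triangle n c i) * f (n - i) (c + i))"
proof -
  have "f n c = (\<Sum>i = 1..n. \<Sum>q\<in>avoiders (n - i). monom 1 (DD n (int c) (prepend_block n i q)))"
    unfolding f_eq_sum by (rule sum_avoiders[OF assms])
  also have "\<dots> = (\<Sum>i = 1..n. monom 1 (triangle n c i) * f (n - i) (c + i))"
    unfolding f_eq_sum sum_distrib_left
    by (intro sum.cong refl) (auto simp: DD_prepend_block mem_avoiders_iff mult_monom)
  finally show ?thesis .
qed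

lemma avoiders_0: "avoiders 0 = {id}"
  by (auto simp: mem_avoiders_iff)

lemma f_0: "f 0 c = 1"
  unfolding f_eq_sum avoiders_0 by (simp add: DD_def)

lemma f_1: "f 1 c = 1"
  using f_recurrence[of 1 c] f_0 by (simp add: triangle_eq)

lemma card_avoiders: "card (avoiders (Suc n)) = 2 ^ n"
proof (induction n rule: less_induct)
  case (less n)
  have "card (avoiders (Suc n)) = (\<Sum>i = 1..Suc n. card (avoiders (Suc n - i)))"
    using sum_avoiders[of "Suc n" "\<lambda>_. 1 :: nat"] by simp
  also have "\<dots> = (\<Sum>k\<le>n. card (avoiders k))"
    by (rule sum.reindex_bij_witness[of _ "\<lambda>k. Suc n - k" "\<lambda>i. Suc n - i"]) auto
  also have "\<dots> = card (avoiders 0) + (\<Sum>k<n. card (avoiders (Suc k)))"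
    by (subst lessThan_Suc_atMost[symmetric]) (simp only: sum.lessThan_Suc_shift)
  also have "\<dots> = 1 + (\<Sum>k<n. 2 ^ k)"
    using less by (simp add: avoiders_0)
  also have "\<dots> = 2 ^ n" by (induction n) auto
  finally show ?case .
qed

lemma DD_eq_0: "n \<le> c \<Longrightarrow> DD n (int c) p = 0"
  by (auto simp: DD_def card_eq_0_iff)

lemma f_large_shift: "n \<le> c \<Longrightarrow> f n c = of_nat (card (avoiders n))"
  unfolding f_eq_sum by (simp add: DD_eq_0)

lemma poly_f_1: "poly (f n c) 1 = int (card (avoiders n))"
  unfolding f_eq_sum by (simp add: poly_sum poly_monom)

section \<open>Solving the recurrence on an antidiagonal\<close>

definition antidiag_sum :: "nat \<Rightarrow> nat \<Rightarrow> int poly" where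
  "antidiag_sum N m = (\<Sum>k<m. f k (N - k))"

abbreviation X :: "int poly" where "X \<equiv> monom 1 1"

lemma antidiag_sum_Suc: "antidiag_sum N (Suc m) = antidiag_sum N m + f m (N - m)"
  by (simp add: antidiag_sum_def)

text \<open>
  After the substitution \<open>k = m - i\<close>, the weight of \<open>f k (N - k)\<close> is \<open>x\<close> exactly for \<open>k < N - m\<close>.
  The hypothesis \<open>N < 2 * m\<close> makes \<open>{..<N - m}\<close> an initial part of the range of summation.
\<close>

lemma f_eq_antidiag_sum:
  assumes "m \<le> N" "N < 2 * m"
  shows "f m (N - m) = antidiag_sum N m + (X - 1) * antidiag_sum N (N - m)"
proof -
  have "f m (N - m) = (\<Sum>i = 1..m. monom 1 (triangle m (N - m) i) * f (m - i) (N - m + i))"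
    using assms by (intro f_recurrence) auto
  also have "\<dots> = (\<Sum>k<m. (if k < N - m then X else 1) * f k (N - k))"
    using assms
    by (intro sum.reindex_bij_witness[of _ "\<lambda>k. m - k" "\<lambda>i. m - i"])
       (auto simp: triangle_eq)
  also have "\<dots> = (\<Sum>k<m. f k (N - k) + (if k < N - m then (X - 1) * f k (N - k) else 0))"
    by (intro sum.cong refl) (auto simp: algebra_simps)
  also have "\<dots> = antidiag_sum N m + (\<Sum>k\<in>{k\<in>{..<m}. k < N - m}. (X - 1) * f k (N - k))"
    by (simp only: sum.distrib antidiag_sum_def sum.inter_filter finite_lessThan)
  also have "{k\<in>{..<m}. k < N - m} = {..<N - m}"
    using assms by auto
  finally show ?thesis by (simp add: antidiag_sum_def sum_distrib_left)
qed

text \<open>In the lower half of the antidiagonal every length is at most its shift.\<close>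

lemma antidiag_sum_small: "2 * m \<le> N \<Longrightarrow> antidiag_sum N (Suc m) = 2 ^ m"
proof (induction m)
  case 0
  then show ?case by (simp add: antidiag_sum_def f_0)
next
  case (Suc m)
  then have "antidiag_sum N (Suc (Suc m)) = 2 ^ m + of_nat (card (avoiders (Suc m)))"
    by (subst antidiag_sum_Suc) (simp add: f_large_shift)
  then show ?case by (simp add: card_avoiders)
qed

definition geom4 :: "nat \<Rightarrow> int poly" where "geom4 M = (\<Sum>k<M. 4 ^ k)"

lemma geom4_Suc: "geom4 (Suc M) = geom4 M + 4 ^ M" by (simp add: geom4_def)
lemma geom4_Suc': "geom4 (Suc M) = 1 + 4 * geom4 M"
  unfolding geom4_def by (simp only: sum.lessThan_Suc_shift) (simp add: sum_distrib_left)

text \<open>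
  With \<open>m = N div 2 + Suc d\<close>, the previous lemmas turn the partial sums into the linear recurrence
  \<open>s (m + 1) = 2 * s m + (x - 1) * 2 ^ (N - m - 1)\<close>, started at the middle of the antidiagonal.
\<close>

lemma antidiag_sum_large:
  "N div 2 + Suc d \<le> N \<Longrightarrow>
     antidiag_sum N (N div 2 + Suc d) = 2 ^ (N div 2 + d) + (X - 1) * 2 ^ (N - (N div 2 + Suc d)) * geom4 d"
proof (induction d)
  case 0
  then show ?case using antidiag_sum_small[of "N div 2" N] by (simp add: geom4_def)
next
  case (Suc d)
  let ?m = "N div 2 + Suc d"
  obtain e where e: "N = Suc (?m + e)"
    using Suc.prems by (metis add_Suc_right le_Suc_ex add_Suc)
  have Nm: "N - ?m = Suc e" using e by linarith
  have "antidiag_sum N (Suc ?m) = 2 * antidiag_sum N ?m + (X - 1) * antidiag_sum N (Suc e)"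
    using f_eq_antidiag_sum[of ?m N] Suc.prems by (simp add: antidiag_sum_Suc Nm del: add_Suc_right)
  also have "antidiag_sum N (Suc e) = 2 ^ e"
    using Nm by (intro antidiag_sum_small) linarith
  also have "antidiag_sum N ?m = 2 ^ (N div 2 + d) + (X - 1) * 2 ^ Suc e * geom4 d"
    using Suc Nm by simp
  finally have "antidiag_sum N (Suc ?m) = 2 ^ (N div 2 + Suc d) + (X - 1) * 2 ^ e * geom4 (Suc d)"
    by (simp add: geom4_Suc' algebra_simps)
  moreover have "N - (N div 2 + Suc (Suc d)) = e" using Nm by linarith
  ultimately show ?case by simp
qed

lemma f_closed_form: "f (Suc n) 0 = 2 ^ n + (X - 1) * geom4 (n div 2)"
proof -
  have N: "Suc n div 2 + Suc (n div 2) = Suc n" by linarith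
  then have "Suc n div 2 + n div 2 = n" by simp
  then have "antidiag_sum (Suc n) (Suc n) = 2 ^ n + (X - 1) * geom4 (n div 2)"
    using antidiag_sum_large[of "Suc n" "n div 2"] N by simp
  moreover have "f (Suc n) 0 = antidiag_sum (Suc n) (Suc n)"
    using f_eq_antidiag_sum[of "Suc n" "Suc n"] by (simp add: antidiag_sum_def[of _ 0])
  ultimately show ?thesis by simp
qed

text \<open>
  The powers of two satisfy the recurrence by themselves; for the geometric sums, passing from
  \<open>n\<close> to \<open>n + 2\<close> adds one power of four, and both parities of \<open>n\<close> can be checked directly.
\<close>

lemma f_linear_recurrence: "f (Suc n + 3) 0 = f (Suc n + 2) 0 + 4 * f (Suc n + 1) 0 - 4 * f (Suc n) 0"
proof -
  obtain k where "n = 2 * k \<or> n = Suc (2 * k)"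
    using even_two_times_div_two odd_two_times_div_two_succ by (metis Suc_eq_plus1)
  then have geom4_eq: "geom4 (Suc (Suc (Suc n)) div 2) =
      geom4 (Suc (Suc n) div 2) + 4 * geom4 (Suc n div 2) - 4 * geom4 (n div 2)"
    by (auto simp: geom4_Suc)
  have index: "Suc n + 3 = Suc (Suc (Suc (Suc n)))" "Suc n + 2 = Suc (Suc (Suc n))"
      "Suc n + 1 = Suc (Suc n)"
    by simp_all
  show ?thesis
    unfolding index f_closed_form geom4_eq by (simp add: algebra_simps)
qed

theorem mainTheorem11:
  fixes S :: "nat list set"
  assumes "S = {[1, 3, 2], [1, 2, 3]}"
  shows
    "(\<forall>n c. 1 \<le> n \<and> c < n \<longrightarrow>
        dd_poly S n c = (\<Sum>i = 1..n. monom 1 (triangle n c i) * dd_poly S (n - i) (c + i))) \<and>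
     (\<forall>c. dd_poly S 0 c = 1 \<and> dd_poly S 1 c = 1) \<and>
     (\<forall>n c. 1 \<le> n \<and> n \<le> c \<longrightarrow>
        dd_poly S n c = of_nat (card (Av n S)) \<and> card (Av n S) = 2 ^ (n - 1)) \<and>
     (\<forall>n c. 1 \<le> n \<longrightarrow> poly (dd_poly S n c) 1 = 2 ^ (n - 1)) \<and>
     (\<forall>n\<ge>1. dd_poly S (n + 3) 0 = dd_poly S (n + 2) 0 + 4 * dd_poly S (n + 1) 0 - 4 * dd_poly S n 0) \<and>
     dd_poly S 0 0 = 1 \<and> dd_poly S 1 0 = 1 \<and> dd_poly S 2 0 = 2 \<and> dd_poly S 3 0 = monom 1 1 + 3"
proof -
  have card: "card (avoiders n) = 2 ^ (n - 1)" if "1 \<le> n" for n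
    using card_avoiders[of "n - 1"] that by simp
  have lin: "f (n + 3) 0 = f (n + 2) 0 + 4 * f (n + 1) 0 - 4 * f n 0" if "1 \<le> n" for n
    using f_linear_recurrence[of "n - 1"] that by simp
  have "f 2 0 = 2" "f 3 0 = X + 3"
    using f_closed_form[of 1] f_closed_form[of 2] by (simp_all add: geom4_def numeral_2_eq_2 numeral_3_eq_3)
  then show ?thesis
    unfolding assms f_def[symmetric] avoiders_def[symmetric]
    by (intro conjI allI impI)
      (simp_all only: f_recurrence[symmetric] f_0 f_1 f_large_shift card poly_f_1 lin
        of_nat_power of_nat_numeral)
qed

end
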